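(* Let $R$ be a right ss-injective ring. The following are equivalent: (1) $S_\ell\subseteq S_r$. (2) $S_\ell=S_r$. (3) $R$ is a left mininjective ring.
   Context: Rings are associative with identity. $S_r=\mathrm{soc}(R_R)$ and $S_\ell=\mathrm{soc}({}_RR)$ are the right and left socles of $R$. A submodule $K$ of a module $N$ is small if $K+L\neq N$ for every proper submodule $L$ of $N$. The ring $R$ is right ss-injective if for every right ideal $K$ of $R$ that is semisimple and small in $R_R$, every right $R$-homomorphism $K\to R_R$ extends to an endomorphism of $R_R$. The ring $R$ is left mininjective if for every simple left ideal $I$ of $R$, every left $R$-homomorphism $I\to {}_RR$ extends to ${}_RR$. *)

theory Defs
  imports "HOL-Algebra.Ideal" "HOL-Algebra.Generated_Groups"
begin

text \<open>
  Rings are noncommutative with identity, and the zero ring is not excluded.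
  The submodules of the regular right (left) module over a ring are its right (left) ideals,
  so the module-theoretic notions are stated for one-sided ideals.
\<close>

locale right_ideal = additive_subgroup I R + ring R for I and R (structure) +
  assumes I_r_closed: "\<lbrakk>a \<in> I; x \<in> carrier R\<rbrakk> \<Longrightarrow> a \<otimes> x \<in> I"

locale left_ideal = additive_subgroup I R + ring R for I and R (structure) +
  assumes I_l_closed: "\<lbrakk>a \<in> I; x \<in> carrier R\<rbrakk> \<Longrightarrow> x \<otimes> a \<in> I"

definition simple_right_ideal :: "'a set \<Rightarrow> ('a, 'b) ring_scheme \<Rightarrow> bool" where
  "simple_right_ideal I R \<longleftrightarrow>
     right_ideal I R \<and> I \<noteq> {\<zero>\<^bsub>R\<^esub>} \<and>
     (\<forall>J. right_ideal J R \<and> J \<subseteq> I \<longrightarrow> J = {\<zero>\<^bsub>R\<^esub>} \<or> J = I)"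

definition simple_left_ideal :: "'a set \<Rightarrow> ('a, 'b) ring_scheme \<Rightarrow> bool" where
  "simple_left_ideal I R \<longleftrightarrow>
     left_ideal I R \<and> I \<noteq> {\<zero>\<^bsub>R\<^esub>} \<and>
     (\<forall>J. left_ideal J R \<and> J \<subseteq> I \<longrightarrow> J = {\<zero>\<^bsub>R\<^esub>} \<or> J = I)"

text \<open>
  The socle of a module is the sum of its simple submodules. The sum of a family of submodules
  is the additive subgroup generated by their union; the empty sum is the zero submodule.
\<close>

definition right_soc :: "('a, 'b) ring_scheme \<Rightarrow> 'a set \<Rightarrow> 'a set" where
  "right_soc R K = generate (add_monoid R) (\<Union>{I. simple_right_ideal I R \<and> I \<subseteq> K})"

definition left_soc :: "('a, 'b) ring_scheme \<Rightarrow> 'a set \<Rightarrow> 'a set" where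
  "left_soc R K = generate (add_monoid R) (\<Union>{I. simple_left_ideal I R \<and> I \<subseteq> K})"

abbreviation right_socle :: "('a, 'b) ring_scheme \<Rightarrow> 'a set" where
  "right_socle R \<equiv> right_soc R (carrier R)"

abbreviation left_socle :: "('a, 'b) ring_scheme \<Rightarrow> 'a set" where
  "left_socle R \<equiv> left_soc R (carrier R)"

definition semisimple_right_ideal :: "'a set \<Rightarrow> ('a, 'b) ring_scheme \<Rightarrow> bool" where
  "semisimple_right_ideal K R \<longleftrightarrow> right_ideal K R \<and> right_soc R K = K"

text \<open>Smallness is meant in the regular right module.\<close>

definition small_right_ideal :: "'a set \<Rightarrow> ('a, 'b) ring_scheme \<Rightarrow> bool" where
  "small_right_ideal K R \<longleftrightarrow>
     right_ideal K R \<and>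
     (\<forall>L. right_ideal L R \<and> L \<noteq> carrier R \<longrightarrow> K <+>\<^bsub>R\<^esub> L \<noteq> carrier R)"

text \<open>
  Homomorphisms from a one-sided ideal to the regular module. Functions are total in HOL, and
  values outside the ideal are unconstrained.
\<close>

definition right_hom :: "('a, 'b) ring_scheme \<Rightarrow> 'a set \<Rightarrow> ('a \<Rightarrow> 'a) set" where
  "right_hom R K =
     {f. f \<in> K \<rightarrow> carrier R \<and>
         (\<forall>x\<in>K. \<forall>y\<in>K. f (x \<oplus>\<^bsub>R\<^esub> y) = f x \<oplus>\<^bsub>R\<^esub> f y) \<and>
         (\<forall>x\<in>K. \<forall>r\<in>carrier R. f (x \<otimes>\<^bsub>R\<^esub> r) = f x \<otimes>\<^bsub>R\<^esub> r)}"

definition left_hom :: "('a, 'b) ring_scheme \<Rightarrow> 'a set \<Rightarrow> ('a \<Rightarrow> 'a) set" where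
  "left_hom R K =
     {f. f \<in> K \<rightarrow> carrier R \<and>
         (\<forall>x\<in>K. \<forall>y\<in>K. f (x \<oplus>\<^bsub>R\<^esub> y) = f x \<oplus>\<^bsub>R\<^esub> f y) \<and>
         (\<forall>x\<in>K. \<forall>r\<in>carrier R. f (r \<otimes>\<^bsub>R\<^esub> x) = r \<otimes>\<^bsub>R\<^esub> f x)}"

definition right_ss_injective :: "('a, 'b) ring_scheme \<Rightarrow> bool" where
  "right_ss_injective R \<longleftrightarrow>
     (\<forall>K. semisimple_right_ideal K R \<and> small_right_ideal K R \<longrightarrow>
        (\<forall>f\<in>right_hom R K. \<exists>g\<in>right_hom R (carrier R). \<forall>x\<in>K. g x = f x))"

definition left_mininjective :: "('a, 'b) ring_scheme \<Rightarrow> bool" where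
  "left_mininjective R \<longleftrightarrow>
     (\<forall>I. simple_left_ideal I R \<longrightarrow>
        (\<forall>f\<in>left_hom R I. \<exists>g\<in>left_hom R (carrier R). \<forall>x\<in>I. g x = f x))"

end

theory Submission
  imports Defs
begin

text \<open>
  Write \<open>l(x)\<close> and \<open>r(x)\<close> for the left and right annihilators of an element \<open>x\<close>. Everything is
  expressed through generators of simple one-sided ideals, and the left-hand notions are the
  right-hand ones of the opposite ring.

  A simple right ideal \<open>xR\<close> is either generated by an idempotent or satisfies \<open>xRx = 0\<close>, and in
  the second case it is small. Homomorphisms from a right ideal generated by an idempotent always
  extend, so right ss-injectivity yields right mininjectivity. For generators this says that
  \<open>r(x) \<subseteq> r(z)\<close> implies \<open>z \<in> Rx\<close> whenever \<open>xR\<close> is simple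
  (lemma \<open>ss_injective_double_annihilator\<close>). It follows that \<open>Rx\<close> is simple too, hence
  \<open>S\<^sub>r \<subseteq> S\<^sub>\<ell>\<close> (lemma \<open>double_annihilator_socle_subset\<close>), so that (1) and (2) are equivalent. The
  same argument in the opposite ring gives (3) \<open>\<Longrightarrow>\<close> (1).

  For (2) \<open>\<Longrightarrow>\<close> (3), let \<open>Rk\<close> be simple and \<open>l(k) \<subseteq> l(a)\<close>; the claim is \<open>a \<in> kR\<close>. Both elements lie
  in \<open>S\<^sub>\<ell> = S\<^sub>r\<close>. As \<open>kR\<close> contains a simple right ideal \<open>xR\<close> and \<open>l(x) = l(k)\<close>, it suffices to treat
  \<open>x\<close> instead of \<open>k\<close> (lemma \<open>ss_injective_socle_left_annihilator\<close>). Suppose \<open>a \<notin> xR\<close>. Split off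
  \<open>xR\<close> from the right socle: there are a right ideal \<open>C\<close> with \<open>C \<inter> xR = 0\<close> and a simple \<open>dR \<subseteq> C\<close>
  such that \<open>l(x) \<subseteq> l(d)\<close>. If \<open>xR\<close> or \<open>dR\<close> is generated by an idempotent, comparing left
  annihilators gives \<open>a \<in> xR\<close> or \<open>x \<in> dR\<close>, both impossible. Otherwise \<open>xR \<oplus> dR\<close> is semisimple and
  small, so the homomorphism with \<open>x \<mapsto> 0\<close> and \<open>d \<mapsto> d\<close> is left multiplication by some \<open>c\<close>. Then
  \<open>cx = 0\<close> but \<open>cd = d \<noteq> 0\<close>, contradicting \<open>l(x) \<subseteq> l(d)\<close>.
\<close>

section \<open>Right ideals and generators of simple right ideals\<close>

text \<open>
  The generators of the simple right ideals (lemmas \<open>simple_right_ideal_minimal\<close> and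
  \<open>right_minimal_simple\<close>). The elementwise form lets simplicity be transferred by computing with
  annihilators.
\<close>

definition right_minimal :: "('a, 'b) ring_scheme \<Rightarrow> 'a \<Rightarrow> bool" where
  "right_minimal R x \<longleftrightarrow> x \<in> carrier R \<and> x \<noteq> \<zero>\<^bsub>R\<^esub> \<and>
     (\<forall>r\<in>carrier R. x \<otimes>\<^bsub>R\<^esub> r \<noteq> \<zero>\<^bsub>R\<^esub> \<longrightarrow> (\<exists>s\<in>carrier R. x \<otimes>\<^bsub>R\<^esub> r \<otimes>\<^bsub>R\<^esub> s = x))"

definition principal_right_ideal :: "('a, 'b) ring_scheme \<Rightarrow> 'a \<Rightarrow> 'a set" where
  "principal_right_ideal R x = (\<lambda>r. x \<otimes>\<^bsub>R\<^esub> r) ` carrier R"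

lemma right_idealI:
  assumes "ring R" "I \<subseteq> carrier R" "\<zero>\<^bsub>R\<^esub> \<in> I"
    and "\<And>x y. x \<in> I \<Longrightarrow> y \<in> I \<Longrightarrow> x \<oplus>\<^bsub>R\<^esub> y \<in> I"
    and "\<And>x r. x \<in> I \<Longrightarrow> r \<in> carrier R \<Longrightarrow> x \<otimes>\<^bsub>R\<^esub> r \<in> I"
  shows "right_ideal I R"
proof -
  interpret ring R by fact
  have "\<ominus>\<^bsub>R\<^esub> x \<in> I" if "x \<in> I" for x
  proof -
    have "x \<in> carrier R" using that assms(2) by blast
    hence "x \<otimes>\<^bsub>R\<^esub> (\<ominus>\<^bsub>R\<^esub> \<one>\<^bsub>R\<^esub>) = \<ominus>\<^bsub>R\<^esub> x" by (simp add: r_minus)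
    thus ?thesis using assms(5)[OF that, of "\<ominus>\<^bsub>R\<^esub> \<one>\<^bsub>R\<^esub>"] by simp
  qed
  hence "subgroup I (add_monoid R)"
    using assms(2-4) by (auto simp: subgroup_def a_inv_def)
  thus ?thesis
    using assms(1,5)
    by (simp add: right_ideal_def right_ideal_axioms_def additive_subgroup_def)
qed

context ring
begin

lemma eq_of_minus_zero:
  assumes "a \<ominus> b = \<zero>" "a \<in> carrier R" "b \<in> carrier R"
  shows "a = b"
  using minus_equality[of a "\<ominus> b"] assms by (simp add: minus_eq)

lemma right_ideal_subset: "right_ideal I R \<Longrightarrow> x \<in> I \<Longrightarrow> x \<in> carrier R"
  by (meson additive_subgroup.a_Hcarr right_ideal.axioms(1))

lemma right_ideal_closed:
  assumes "right_ideal I R"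
  shows "\<zero> \<in> I" "x \<in> I \<Longrightarrow> y \<in> I \<Longrightarrow> x \<oplus> y \<in> I" "x \<in> I \<Longrightarrow> r \<in> carrier R \<Longrightarrow> x \<otimes> r \<in> I"
    "x \<in> I \<Longrightarrow> \<ominus> x \<in> I"
proof -
  interpret right_ideal I R by fact
  show "\<zero> \<in> I" "x \<in> I \<Longrightarrow> y \<in> I \<Longrightarrow> x \<oplus> y \<in> I" "x \<in> I \<Longrightarrow> r \<in> carrier R \<Longrightarrow> x \<otimes> r \<in> I"
    "x \<in> I \<Longrightarrow> \<ominus> x \<in> I"
    using I_r_closed by (auto simp: a_inv_closed)
qed

lemma mem_principal_right_ideal: "x \<in> carrier R \<Longrightarrow> x \<in> principal_right_ideal R x"
  by (metis imageI one_closed principal_right_ideal_def r_one)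

lemma right_ideal_sum_principal:
  assumes "right_ideal I R" "x \<in> carrier R"
  shows "right_ideal (I <+>\<^bsub>R\<^esub> principal_right_ideal R x) R"
proof (rule right_idealI)
  note cl = right_ideal_closed[OF assms(1)] right_ideal_subset[OF assms(1)]
  show "ring R" by (rule ring_axioms)
  show "I <+>\<^bsub>R\<^esub> principal_right_ideal R x \<subseteq> carrier R"
    using cl assms(2) by (auto simp: set_add_def' principal_right_ideal_def)
  have "\<zero> = \<zero> \<oplus> x \<otimes> \<zero>" using assms(2) by simp
  thus "\<zero> \<in> I <+>\<^bsub>R\<^esub> principal_right_ideal R x"
    using cl(1) unfolding set_add_def' principal_right_ideal_def by blast
next
  note cl = right_ideal_closed[OF assms(1)] right_ideal_subset[OF assms(1)]
  fix y z assume "y \<in> I <+>\<^bsub>R\<^esub> principal_right_ideal R x" "z \<in> I <+>\<^bsub>R\<^esub> principal_right_ideal R x"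
  then obtain i j r s where h: "i \<in> I" "j \<in> I" "r \<in> carrier R" "s \<in> carrier R"
    "y = i \<oplus> x \<otimes> r" "z = j \<oplus> x \<otimes> s"
    by (auto simp: set_add_def' principal_right_ideal_def)
  have "y \<oplus> z = (i \<oplus> j) \<oplus> x \<otimes> (r \<oplus> s)"
    using h cl assms(2) by (simp add: r_distr a_ac)
  thus "y \<oplus> z \<in> I <+>\<^bsub>R\<^esub> principal_right_ideal R x"
    using h cl(2) unfolding set_add_def' principal_right_ideal_def by blast
next
  note cl = right_ideal_closed[OF assms(1)] right_ideal_subset[OF assms(1)]
  fix y t assume "y \<in> I <+>\<^bsub>R\<^esub> principal_right_ideal R x" and t: "t \<in> carrier R"
  then obtain i r where h: "i \<in> I" "r \<in> carrier R" "y = i \<oplus> x \<otimes> r"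
    by (auto simp: set_add_def' principal_right_ideal_def)
  have "y \<otimes> t = i \<otimes> t \<oplus> x \<otimes> (r \<otimes> t)"
    using h t cl assms(2) by (simp add: l_distr m_assoc)
  thus "y \<otimes> t \<in> I <+>\<^bsub>R\<^esub> principal_right_ideal R x"
    using h t cl(3) unfolding set_add_def' principal_right_ideal_def by blast
qed

lemma sum_principal_upper:
  assumes "right_ideal I R" "x \<in> carrier R"
  shows "I \<subseteq> I <+>\<^bsub>R\<^esub> principal_right_ideal R x"
    and "x \<in> I <+>\<^bsub>R\<^esub> principal_right_ideal R x"
proof -
  have mem: "c \<oplus> x \<otimes> r \<in> I <+>\<^bsub>R\<^esub> principal_right_ideal R x" if "c \<in> I" "r \<in> carrier R" for c r
    using that unfolding set_add_def' principal_right_ideal_def by blast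
  show "I \<subseteq> I <+>\<^bsub>R\<^esub> principal_right_ideal R x"
  proof
    fix c assume c: "c \<in> I"
    hence "c \<in> carrier R" by (rule right_ideal_subset[OF assms(1)])
    thus "c \<in> I <+>\<^bsub>R\<^esub> principal_right_ideal R x"
      using mem[OF c zero_closed] assms(2) by simp
  qed
  show "x \<in> I <+>\<^bsub>R\<^esub> principal_right_ideal R x"
    using mem[OF right_ideal_closed(1)[OF assms(1)] one_closed] assms(2) by simp
qed

lemma right_ideal_zero: "right_ideal {\<zero>} R"
  by (rule right_idealI) (auto simp: ring_axioms)

lemma right_ideal_principal:
  assumes "x \<in> carrier R" shows "right_ideal (principal_right_ideal R x) R"
proof -
  have "{\<zero>} <+>\<^bsub>R\<^esub> principal_right_ideal R x = principal_right_ideal R x"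
    using assms by (auto simp: set_add_def' principal_right_ideal_def)
  thus ?thesis using right_ideal_sum_principal[OF right_ideal_zero assms] by simp
qed

lemma principal_right_ideal_least:
  assumes "right_ideal I R" "x \<in> I" shows "principal_right_ideal R x \<subseteq> I"
  using assms right_ideal_closed(3) by (auto simp: principal_right_ideal_def)

lemma right_minimalD:
  assumes "right_minimal R x"
  shows "x \<in> carrier R" "x \<noteq> \<zero>"
    "r \<in> carrier R \<Longrightarrow> x \<otimes> r \<noteq> \<zero> \<Longrightarrow> \<exists>s\<in>carrier R. x \<otimes> r \<otimes> s = x"
  using assms by (auto simp: right_minimal_def)

lemma simple_right_ideal_generator:
  assumes "simple_right_ideal I R" "x \<in> I" "x \<noteq> \<zero>"
  shows "principal_right_ideal R x = I"
proof -
  have I: "right_ideal I R" using assms by (simp add: simple_right_ideal_def)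
  have x: "x \<in> carrier R" using right_ideal_subset I assms by blast
  show ?thesis
    using assms mem_principal_right_ideal[OF x] right_ideal_principal[OF x]
      principal_right_ideal_least[OF I assms(2)]
    unfolding simple_right_ideal_def by blast
qed

lemma simple_right_ideal_minimal:
  assumes "simple_right_ideal I R" "x \<in> I" "x \<noteq> \<zero>"
  shows "right_minimal R x"
proof -
  have I: "right_ideal I R" using assms by (simp add: simple_right_ideal_def)
  have x: "x \<in> carrier R" using right_ideal_subset I assms by blast
  have "\<exists>s\<in>carrier R. x \<otimes> r \<otimes> s = x" if "r \<in> carrier R" "x \<otimes> r \<noteq> \<zero>" for r
  proof -
    have "x \<in> principal_right_ideal R (x \<otimes> r)"
      using simple_right_ideal_generator[OF assms(1) _ that(2)] right_ideal_closed(3)[OF I assms(2) that(1)]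
        assms(2) by blast
    thus ?thesis unfolding principal_right_ideal_def by force
  qed
  thus ?thesis using x assms(3) by (simp add: right_minimal_def)
qed

lemma right_minimal_simple:
  assumes "right_minimal R x"
  shows "simple_right_ideal (principal_right_ideal R x) R"
  unfolding simple_right_ideal_def
proof (intro conjI allI impI)
  note x = right_minimalD[OF assms]
  show "right_ideal (principal_right_ideal R x) R" by (rule right_ideal_principal[OF x(1)])
  show "principal_right_ideal R x \<noteq> {\<zero>}" using mem_principal_right_ideal x by blast
  fix J assume J: "right_ideal J R \<and> J \<subseteq> principal_right_ideal R x"
  show "J = {\<zero>} \<or> J = principal_right_ideal R x"
  proof (cases "J \<subseteq> {\<zero>}")
    case True
    thus ?thesis using J right_ideal_closed(1) by blast
  next
    case False
    then obtain y where y: "y \<in> J" "y \<noteq> \<zero>" by blast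
    then obtain r where r: "r \<in> carrier R" "y = x \<otimes> r"
      using J by (auto simp: principal_right_ideal_def)
    then obtain s where "s \<in> carrier R" "y \<otimes> s = x" using x(3) y by blast
    hence "x \<in> J" using J y right_ideal_closed(3) by blast
    thus ?thesis using principal_right_ideal_least J by blast
  qed
qed

text \<open>
  Passing from simple ideals to their generators replaces a sum of ideals by an additive span of
  elements, to which induction on sums applies.
\<close>

lemma right_soc_eq_generate:
  assumes "right_ideal K R"
  shows "right_soc R K = generate (add_monoid R) {x \<in> K. right_minimal R x}"
proof
  let ?M = "{x \<in> K. right_minimal R x}" and ?U = "\<Union>{I. simple_right_ideal I R \<and> I \<subseteq> K}"
  have sub: "?M \<subseteq> carrier R" by (auto simp: right_minimal_def)
  have "?U \<subseteq> generate (add_monoid R) ?M"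
  proof
    fix x assume "x \<in> ?U"
    then obtain I where I: "simple_right_ideal I R" "I \<subseteq> K" "x \<in> I" by blast
    show "x \<in> generate (add_monoid R) ?M"
    proof (cases "x = \<zero>")
      case True
      thus ?thesis using generate.one[of "add_monoid R" ?M] by simp
    next
      case False
      hence "x \<in> ?M" using simple_right_ideal_minimal I by blast
      thus ?thesis by (rule generate.incl)
    qed
  qed
  thus "right_soc R K \<subseteq> generate (add_monoid R) ?M"
    unfolding right_soc_def
    using add.generate_subgroup_incl[OF _ add.generate_is_subgroup] sub by simp
  have "?M \<subseteq> ?U"
  proof
    fix x assume "x \<in> ?M"
    hence x: "x \<in> K" "right_minimal R x" by auto
    hence "principal_right_ideal R x \<subseteq> K" "x \<in> principal_right_ideal R x"
      using principal_right_ideal_least[OF assms] mem_principal_right_ideal right_minimalD(1) by auto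
    thus "x \<in> ?U" using right_minimal_simple[OF x(2)] by blast
  qed
  thus "generate (add_monoid R) ?M \<subseteq> right_soc R K"
    unfolding right_soc_def by (rule add.mono_generate)
qed

lemma right_ideal_carrier: "right_ideal (carrier R) R"
  by (rule right_idealI) (auto simp: ring_axioms)

lemma right_socle_eq_generate:
  "right_socle R = generate (add_monoid R) {x. right_minimal R x}"
proof -
  have "{x \<in> carrier R. right_minimal R x} = {x. right_minimal R x}"
    by (auto simp: right_minimal_def)
  thus ?thesis using right_soc_eq_generate[OF right_ideal_carrier] by simp
qed

text \<open>
  Since \<open>r(x) \<subseteq> r(z)\<close>, the map \<open>xr \<mapsto> zr\<close> is a well-defined epimorphism from the simple module
  \<open>xR\<close> onto \<open>zR\<close>.
\<close>

lemma right_minimal_annihilator: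
  assumes x: "right_minimal R x" and z: "z \<in> carrier R" "z \<noteq> \<zero>"
    and ann: "\<And>r. r \<in> carrier R \<Longrightarrow> x \<otimes> r = \<zero> \<Longrightarrow> z \<otimes> r = \<zero>"
  shows "right_minimal R z"
  unfolding right_minimal_def
proof (intro conjI ballI impI z)
  fix r assume r: "r \<in> carrier R" "z \<otimes> r \<noteq> \<zero>"
  then obtain s where s: "s \<in> carrier R" "x \<otimes> r \<otimes> s = x"
    using right_minimalD(3)[OF x r(1)] ann by blast
  have "x \<otimes> (r \<otimes> s \<ominus> \<one>) = \<zero>"
    using right_minimalD(1)[OF x] r s by (simp add: minus_eq r_distr r_minus m_assoc[symmetric] r_neg)
  hence "z \<otimes> (r \<otimes> s \<ominus> \<one>) = \<zero>" using ann r s by simp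
  hence "z \<otimes> r \<otimes> s \<ominus> z = \<zero>"
    using z r s by (simp add: minus_eq r_distr r_minus m_assoc[symmetric])
  hence "z \<otimes> r \<otimes> s = z" by (rule eq_of_minus_zero) (use z r s in simp_all)
  thus "\<exists>s\<in>carrier R. z \<otimes> r \<otimes> s = z" using s by blast
qed

lemma right_minimal_mult:
  assumes "right_minimal R x" "r \<in> carrier R" "x \<otimes> r \<noteq> \<zero>"
  shows "right_minimal R (x \<otimes> r)"
proof (rule simple_right_ideal_minimal)
  show "simple_right_ideal (principal_right_ideal R x) R" by (rule right_minimal_simple[OF assms(1)])
  show "x \<otimes> r \<in> principal_right_ideal R x" using assms(2) by (simp add: principal_right_ideal_def)
  show "x \<otimes> r \<noteq> \<zero>" by fact
qed

section \<open>The right socle\<close>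

lemma right_minimal_minus:
  assumes "right_minimal R x"
  shows "right_minimal R (\<ominus> x)"
proof (rule right_minimal_annihilator[OF assms])
  note x = right_minimalD(1,2)[OF assms]
  show "\<ominus> x \<in> carrier R" using x by simp
  show "\<ominus> x \<noteq> \<zero>" using x minus_minus by fastforce
  show "\<ominus> x \<otimes> r = \<zero>" if "r \<in> carrier R" "x \<otimes> r = \<zero>" for r
    using x that by (simp add: l_minus)
qed

text \<open>
  The generators are closed under negation, so every element of the socle is a finite sum of them
  and induction may add one generator at a time.
\<close>

lemma right_socle_induct [consumes 1, case_names zero add]:
  assumes "a \<in> right_socle R"
    and zero: "P \<zero>"
    and add: "\<And>t y. right_minimal R t \<Longrightarrow> y \<in> carrier R \<Longrightarrow> P y \<Longrightarrow> P (t \<oplus> y)"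
  shows "P a"
proof -
  have "a \<in> generate (add_monoid R) {x. right_minimal R x}"
    using assms(1) by (simp add: right_socle_eq_generate)
  hence "a \<in> carrier R \<and> (\<forall>y\<in>carrier R. P y \<longrightarrow> P (a \<oplus> y))"
  proof induction
    case one
    show ?case by simp
  next
    case (incl h)
    thus ?case using add by (blast dest: right_minimalD(1))
  next
    case (inv h)
    hence "right_minimal R (\<ominus> h)" using right_minimal_minus by blast
    hence "\<ominus> h \<in> carrier R \<and> (\<forall>y\<in>carrier R. P y \<longrightarrow> P (\<ominus> h \<oplus> y))"
      using add by (blast dest: right_minimalD(1))
    thus ?case unfolding a_inv_def .
  next
    case (eng h1 h2)
    then have h: "h1 \<in> carrier R" "h2 \<in> carrier R" by simp_all
    have step1: "P (h1 \<oplus> y)" if "y \<in> carrier R" "P y" for y using eng.IH(1)[THEN conjunct2, THEN bspec] that by iprover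
    have step2: "P (h2 \<oplus> y)" if "y \<in> carrier R" "P y" for y using eng.IH(2)[THEN conjunct2, THEN bspec] that by iprover
    have "P (h1 \<oplus> h2 \<oplus> y)" if y: "y \<in> carrier R" "P y" for y
      unfolding a_assoc[OF h y(1)]
      by (rule step1[OF a_closed[OF h(2) y(1)] step2[OF y]])
    moreover have "h1 \<oplus> h2 \<in> carrier R" using h by (rule a_closed)
    ultimately show ?case by simp
  qed
  hence a: "a \<in> carrier R" and Pa: "P (a \<oplus> \<zero>)"
    using zero bspec[OF _ zero_closed] by iprover+
  show ?thesis using Pa unfolding r_zero[OF a] .
qed

lemma right_socle_carrier: "a \<in> right_socle R \<Longrightarrow> a \<in> carrier R"
proof (induction rule: right_socle_induct)
  case zero
  show ?case by (rule zero_closed)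
next
  case (add t y)
  thus ?case by (blast intro: a_closed right_minimalD(1))
qed

lemma right_socle_closed:
  shows "right_minimal R x \<Longrightarrow> x \<in> right_socle R"
    and "a \<in> right_socle R \<Longrightarrow> b \<in> right_socle R \<Longrightarrow> a \<oplus> b \<in> right_socle R"
  unfolding right_socle_eq_generate
  by (rule generate.incl, simp) (drule (1) generate.eng, simp)

text \<open>
  Nonzero submodules of a semisimple module contain simple ones. For \<open>a = t + y\<close> with \<open>tR\<close> simple,
  either some multiple of \<open>ar\<close> has zero first summand and is a nonzero multiple of \<open>y\<close>, where
  induction applies, or everything that \<open>tr\<close> annihilates is annihilated by \<open>ar\<close>. In the latter case
  \<open>tr \<noteq> 0\<close> and \<open>arR\<close> is an image of the simple module \<open>trR\<close>.
\<close>

lemma right_socle_minimal_multiple: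
  assumes "a \<in> right_socle R" "r \<in> carrier R" "a \<otimes> r \<noteq> \<zero>"
  shows "\<exists>s\<in>carrier R. right_minimal R (a \<otimes> r \<otimes> s)"
  using assms
proof (induction arbitrary: r rule: right_socle_induct)
  case zero
  thus ?case by simp
next
  case (add t y)
  note t = right_minimalD[OF add.hyps(1)]
  show ?case
  proof (cases "\<exists>w\<in>carrier R. t \<otimes> r \<otimes> w = \<zero> \<and> (t \<oplus> y) \<otimes> r \<otimes> w \<noteq> \<zero>")
    case True
    then obtain w where w: "w \<in> carrier R" "t \<otimes> r \<otimes> w = \<zero>" "(t \<oplus> y) \<otimes> r \<otimes> w \<noteq> \<zero>" by blast
    have eq: "(t \<oplus> y) \<otimes> r \<otimes> w = y \<otimes> (r \<otimes> w)"
      using w add.hyps(2) add.prems t(1) by (simp add: l_distr m_assoc)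
    then obtain s where "s \<in> carrier R" "right_minimal R (y \<otimes> (r \<otimes> w) \<otimes> s)"
      using add.IH[of "r \<otimes> w"] w add.prems by auto
    thus ?thesis
      using w add.hyps(2) add.prems t(1) eq
      by (intro bexI[of _ "w \<otimes> s"]) (simp_all add: m_assoc[symmetric])
  next
    case False
    then have ann: "(t \<oplus> y) \<otimes> r \<otimes> w = \<zero>" if "w \<in> carrier R" "t \<otimes> r \<otimes> w = \<zero>" for w
      using that by blast
    have zr: "(t \<oplus> y) \<otimes> r \<in> carrier R" using add.prems(1) add.hyps(2) t(1) by simp
    have "t \<otimes> r \<noteq> \<zero>"
      using ann[OF one_closed] zr add.prems t(1) by (metis m_closed r_one)
    hence "right_minimal R (t \<otimes> r)" by (rule right_minimal_mult[OF add.hyps(1) add.prems(1)])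
    hence "right_minimal R ((t \<oplus> y) \<otimes> r \<otimes> \<one>)"
      unfolding r_one[OF zr] by (rule right_minimal_annihilator[OF _ zr add.prems(2) ann])
    thus ?thesis using one_closed by blast
  qed
qed

lemma right_socle_contains_minimal:
  assumes "a \<in> right_socle R" "a \<noteq> \<zero>"
  shows "\<exists>s\<in>carrier R. right_minimal R (a \<otimes> s)"
  using right_socle_minimal_multiple[OF assms(1) one_closed] right_socle_carrier[OF assms(1)] assms(2)
  by (simp only: r_one not_False_eq_True simp_thms)

lemma maximal_right_ideal_avoiding:
  assumes x: "x \<noteq> \<zero>"
  obtains C where "right_ideal C R" "x \<notin> C"
    "\<And>D. right_ideal D R \<Longrightarrow> C \<subseteq> D \<Longrightarrow> x \<notin> D \<Longrightarrow> D = C"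
proof -
  let ?A = "{D. right_ideal D R \<and> x \<notin> D}"
  have "\<exists>M\<in>?A. \<forall>X\<in>?A. M \<subseteq> X \<longrightarrow> X = M"
  proof (rule subset_Zorn_nonempty)
    show "?A \<noteq> {}" using right_ideal_zero x by blast
    fix \<C> assume ne: "\<C> \<noteq> {}" and ch: "subset.chain ?A \<C>"
    have ideals: "right_ideal D R" "x \<notin> D" if "D \<in> \<C>" for D
      using that ch by (auto simp: subset.chain_def)
    have "right_ideal (\<Union>\<C>) R"
    proof (rule right_idealI)
      show "ring R" by (rule ring_axioms)
      show "\<Union>\<C> \<subseteq> carrier R" using ideals right_ideal_subset by blast
      show "\<zero> \<in> \<Union>\<C>" using ne ideals right_ideal_closed(1) by blast
      show "a \<otimes> r \<in> \<Union>\<C>" if "a \<in> \<Union>\<C>" "r \<in> carrier R" for a r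
        using that ideals right_ideal_closed(3) by blast
      fix a b assume "a \<in> \<Union>\<C>" "b \<in> \<Union>\<C>"
      then obtain D E where DE: "D \<in> \<C>" "E \<in> \<C>" "a \<in> D" "b \<in> E" by blast
      hence "D \<subseteq> E \<or> E \<subseteq> D" using ch by (auto simp: subset.chain_def)
      thus "a \<oplus> b \<in> \<Union>\<C>" using DE ideals right_ideal_closed(2) by blast
    qed
    thus "\<Union>\<C> \<in> ?A" using ideals by blast
  qed
  then obtain C where "C \<in> ?A" "\<forall>X\<in>?A. C \<subseteq> X \<longrightarrow> X = C" ..
  thus thesis by (intro that[of C]) simp_all
qed

text \<open>
  For simple \<open>xR\<close> the condition \<open>x \<notin> C\<close> means \<open>C \<inter> xR = 0\<close>. For \<open>C\<close> maximal with this property,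
  every simple \<open>tR\<close> outside \<open>C\<close> satisfies \<open>x \<in> C + tR\<close>, and the exchange argument turns this into
  \<open>t \<in> C + xR\<close>.
\<close>

lemma right_socle_complement:
  assumes x: "right_minimal R x"
  shows "\<exists>C. right_ideal C R \<and> x \<notin> C \<and> right_socle R \<subseteq> C <+>\<^bsub>R\<^esub> principal_right_ideal R x"
proof -
  obtain C where C: "right_ideal C R" "x \<notin> C"
    and max: "\<And>D. right_ideal D R \<Longrightarrow> C \<subseteq> D \<Longrightarrow> x \<notin> D \<Longrightarrow> D = C"
    by (rule maximal_right_ideal_avoiding[OF right_minimalD(2)[OF x]], rule that)
  note xc = right_minimalD(1)[OF x]
  let ?S = "C <+>\<^bsub>R\<^esub> principal_right_ideal R x"
  have S: "right_ideal ?S R" by (rule right_ideal_sum_principal[OF C(1) xc])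
  note CS = sum_principal_upper[OF C(1) xc]
  have minimal: "t \<in> ?S" if t: "right_minimal R t" for t
  proof (cases "t \<in> C")
    case True
    thus ?thesis using CS by blast
  next
    case False
    note tc = right_minimalD(1)[OF t]
    let ?D = "C <+>\<^bsub>R\<^esub> principal_right_ideal R t"
    have D: "right_ideal ?D R" by (rule right_ideal_sum_principal[OF C(1) tc])
    note CD = sum_principal_upper[OF C(1) tc]
    have "x \<in> ?D"
    proof (rule ccontr)
      assume "x \<notin> ?D"
      hence "?D = C" by (rule max[OF D CD(1)])
      thus False using CD(2) False by simp
    qed
    then obtain c r where c: "c \<in> C" "r \<in> carrier R" "x = c \<oplus> t \<otimes> r"
      by (auto simp: set_add_def' principal_right_ideal_def)
    note cc = right_ideal_subset[OF C(1) c(1)]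
    have "t \<otimes> r \<noteq> \<zero>"
    proof
      assume "t \<otimes> r = \<zero>"
      hence "x = c" using c(3) cc by simp
      thus False using c(1) C(2) by simp
    qed
    then obtain s where s: "s \<in> carrier R" "t \<otimes> r \<otimes> s = t" using right_minimalD(3)[OF t c(2)] by blast
    have "t \<otimes> r = \<ominus> c \<oplus> x" using c cc tc by (simp add: r_neg1)
    moreover have "\<ominus> c \<oplus> x \<in> ?S"
      by (intro right_ideal_closed(2,4)[OF S] CS(2) subsetD[OF CS(1) c(1)])
    ultimately have "t \<otimes> r \<otimes> s \<in> ?S" by (simp only: right_ideal_closed(3)[OF S _ s(1)])
    thus ?thesis by (simp only: s(2))
  qed
  have "a \<in> ?S" if "a \<in> right_socle R" for a
    using that
  proof (induction rule: right_socle_induct)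
    case zero
    show ?case by (rule right_ideal_closed(1)[OF S])
  next
    case (add t y)
    show ?case by (rule right_ideal_closed(2)[OF S minimal[OF add.hyps(1)] add.IH])
  qed
  thus ?thesis using C by blast
qed

section \<open>Small ideals and extension of homomorphisms\<close>

text \<open>
  Brauer's lemma. If \<open>xRx \<noteq> 0\<close>, then \<open>xrxs = x\<close> for some \<open>r\<close> and \<open>s\<close>, and \<open>e = xsr\<close> satisfies
  \<open>(xr)(ex - x) = 0\<close>. If \<open>ex - x\<close> were nonzero, it would generate \<open>xR\<close>, making \<open>xrx\<close> zero. Thus
  \<open>ex = x\<close>. In the second alternative \<open>xw\<close> is an idempotent generating \<open>xR\<close>.
\<close>

lemma right_minimal_square_zero_or_idempotent:
  assumes x: "right_minimal R x"
  shows "(\<forall>r\<in>carrier R. x \<otimes> r \<otimes> x = \<zero>) \<or> (\<exists>w\<in>carrier R. x \<otimes> w \<otimes> x = x)"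
proof (rule disjCI)
  note xc = right_minimalD(1)[OF x]
  assume no: "\<not> (\<exists>w\<in>carrier R. x \<otimes> w \<otimes> x = x)"
  show "\<forall>r\<in>carrier R. x \<otimes> r \<otimes> x = \<zero>"
  proof (rule ballI, rule ccontr)
    fix r assume r: "r \<in> carrier R" and nz: "x \<otimes> r \<otimes> x \<noteq> \<zero>"
    then obtain s where s: "s \<in> carrier R" "x \<otimes> r \<otimes> x \<otimes> s = x"
      using right_minimalD(3)[OF x, of "r \<otimes> x"] xc by (auto simp: m_assoc)
    let ?v = "s \<otimes> r \<otimes> x \<ominus> \<one>"
    have v: "?v \<in> carrier R" using s r xc by simp
    have "x \<otimes> ?v \<noteq> \<zero>"
    proof
      assume "x \<otimes> ?v = \<zero>"
      hence "x \<otimes> (s \<otimes> r) \<otimes> x \<ominus> x = \<zero>"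
        using s(1) r xc by (simp add: minus_eq r_distr r_minus m_assoc)
      hence "x \<otimes> (s \<otimes> r) \<otimes> x = x" by (rule eq_of_minus_zero) (use s(1) r xc in simp_all)
      thus False using no s r by blast
    qed
    then obtain u where u: "u \<in> carrier R" "x \<otimes> ?v \<otimes> u = x" using right_minimalD(3)[OF x v] by blast
    have "x \<otimes> r \<otimes> x \<otimes> ?v = x \<otimes> r \<otimes> x \<otimes> s \<otimes> (r \<otimes> x) \<ominus> x \<otimes> r \<otimes> x"
      using s(1) r xc by (simp add: minus_eq r_distr r_minus m_assoc)
    also have "\<dots> = \<zero>" using s r xc by (simp add: m_assoc[symmetric]) (simp add: minus_eq r_neg)
    finally have "x \<otimes> r \<otimes> x \<otimes> ?v \<otimes> u = \<zero>" using u by simp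
    hence "x \<otimes> r \<otimes> (x \<otimes> ?v \<otimes> u) = \<zero>" using xc r v u(1) by (simp add: m_assoc)
    thus False using u nz by simp
  qed
qed

text \<open>
  Write \<open>1 = l + xr\<close> with \<open>l \<in> L\<close>. Since \<open>(xr)\<^sup>2 = 0\<close>, multiplying by \<open>xr\<close> on the right gives
  \<open>xr = l(xr) \<in> L\<close>, and therefore \<open>1 \<in> L\<close>.
\<close>

lemma small_principal_right_ideal:
  assumes x: "x \<in> carrier R" and nil: "\<forall>r\<in>carrier R. x \<otimes> r \<otimes> x = \<zero>"
    and L: "right_ideal L R" and sum: "\<one> \<in> L <+>\<^bsub>R\<^esub> principal_right_ideal R x"
  shows "L = carrier R"
proof -
  obtain l r where h: "l \<in> L" "r \<in> carrier R" "\<one> = l \<oplus> x \<otimes> r"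
    using sum by (auto simp: set_add_def' principal_right_ideal_def)
  have l: "l \<in> carrier R" by (rule right_ideal_subset[OF L h(1)])
  have "x \<otimes> r \<otimes> x \<otimes> r = \<zero>" using nil h(2) by simp
  hence sq: "x \<otimes> r \<otimes> (x \<otimes> r) = \<zero>" using x h(2) by (simp add: m_assoc)
  have "x \<otimes> r = (l \<oplus> x \<otimes> r) \<otimes> (x \<otimes> r)" using h(2) x by (simp flip: h(3))
  also have "\<dots> = l \<otimes> (x \<otimes> r)" using h(2) x l by (simp add: l_distr sq)
  finally have "x \<otimes> r \<in> L" using right_ideal_closed(3)[OF L h(1), of "x \<otimes> r"] x h(2) by simp
  hence one: "\<one> \<in> L" using right_ideal_closed(2)[OF L h(1)] h(3) by simp
  have "a \<in> L" if "a \<in> carrier R" for a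
    using right_ideal_closed(3)[OF L one that] that by simp
  thus ?thesis using right_ideal_subset[OF L] by blast
qed

text \<open>
  The hypothesis on \<open>u\<close> and \<open>v\<close> says that \<open>xp + dq \<mapsto> up + vq\<close> is well defined on \<open>xR + dR\<close>, and
  the square-zero conditions make this semisimple right ideal small. The sum need not be direct,
  so that taking \<open>d = x\<close> covers homomorphisms defined on \<open>xR\<close> alone.
\<close>

lemma ss_injective_left_multiplication:
  assumes inj: "right_ss_injective R"
    and x: "right_minimal R x" "\<forall>r\<in>carrier R. x \<otimes> r \<otimes> x = \<zero>"
    and d: "right_minimal R d" "\<forall>r\<in>carrier R. d \<otimes> r \<otimes> d = \<zero>"
    and u: "u \<in> carrier R" and v: "v \<in> carrier R"
    and ann: "\<And>p q. p \<in> carrier R \<Longrightarrow> q \<in> carrier R \<Longrightarrow> x \<otimes> p \<oplus> d \<otimes> q = \<zero> \<Longrightarrow> u \<otimes> p \<oplus> v \<otimes> q = \<zero>"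
  obtains c where "c \<in> carrier R" "c \<otimes> x = u" "c \<otimes> d = v"
proof -
  note xc = right_minimalD(1)[OF x(1)] and dc = right_minimalD(1)[OF d(1)]
  let ?K = "principal_right_ideal R x <+>\<^bsub>R\<^esub> principal_right_ideal R d"
  have X: "right_ideal (principal_right_ideal R x) R" by (rule right_ideal_principal[OF xc])
  have K: "right_ideal ?K R" by (rule right_ideal_sum_principal[OF X dc])
  have Kc: "?K \<subseteq> carrier R" using right_ideal_subset[OF K] by blast
  have xK: "x \<in> ?K" using sum_principal_upper(1)[OF X dc] mem_principal_right_ideal[OF xc] by blast
  have dK: "d \<in> ?K" by (rule sum_principal_upper(2)[OF X dc])
  have K_mem: "\<exists>p\<in>carrier R. \<exists>q\<in>carrier R. y = x \<otimes> p \<oplus> d \<otimes> q" if "y \<in> ?K" for y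
    using that by (auto simp: set_add_def' principal_right_ideal_def)
  have semisimple: "semisimple_right_ideal ?K R"
  proof -
    interpret S: subgroup "generate (add_monoid R) {z \<in> ?K. right_minimal R z}" "add_monoid R"
      by (rule add.generate_is_subgroup) (auto simp: right_minimal_def)
    have mult: "t \<otimes> p \<in> generate (add_monoid R) {z \<in> ?K. right_minimal R z}"
      if "right_minimal R t" "t \<in> ?K" "p \<in> carrier R" for t p
    proof (cases "t \<otimes> p = \<zero>")
      case True
      thus ?thesis using S.one_closed by simp
    next
      case False
      show ?thesis
        using right_minimal_mult[OF that(1,3) False] right_ideal_closed(3)[OF K that(2,3)]
        by (intro generate.incl) simp
    qed
    have "?K \<subseteq> generate (add_monoid R) {z \<in> ?K. right_minimal R z}"
    proof
      fix y assume "y \<in> ?K"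
      then obtain p q where pq: "p \<in> carrier R" "q \<in> carrier R" "y = x \<otimes> p \<oplus> d \<otimes> q"
        using K_mem by blast
      show "y \<in> generate (add_monoid R) {z \<in> ?K. right_minimal R z}"
        using S.m_closed[OF mult[OF x(1) xK pq(1)] mult[OF d(1) dK pq(2)]] pq(3) by simp
    qed
    moreover have "generate (add_monoid R) {z \<in> ?K. right_minimal R z} \<subseteq> ?K"
      using K by (intro add.generate_subgroup_incl)
        (auto simp: right_ideal_def additive_subgroup_def)
    ultimately have "right_soc R ?K = ?K" unfolding right_soc_eq_generate[OF K] by blast
    thus ?thesis using K by (simp add: semisimple_right_ideal_def)
  qed
  have small: "small_right_ideal ?K R"
    unfolding small_right_ideal_def
  proof (intro conjI allI impI K notI)
    fix L assume "right_ideal L R \<and> L \<noteq> carrier R" and eq: "?K <+>\<^bsub>R\<^esub> L = carrier R"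
    hence L: "right_ideal L R" "L \<noteq> carrier R" by blast+
    let ?M = "L <+>\<^bsub>R\<^esub> principal_right_ideal R x"
    have M: "right_ideal ?M R" by (rule right_ideal_sum_principal[OF L(1) xc])
    \<comment> \<open>A sum of two small ideals is small: first \<open>dR\<close> and then \<open>xR\<close> can be cancelled.\<close>
    have "\<one> \<in> ?K <+>\<^bsub>R\<^esub> L" unfolding eq by (rule one_closed)
    then obtain p q l where h: "p \<in> carrier R" "q \<in> carrier R" "l \<in> L" "\<one> = x \<otimes> p \<oplus> d \<otimes> q \<oplus> l"
      by (auto simp: set_add_def' principal_right_ideal_def)
    have "\<one> = (l \<oplus> x \<otimes> p) \<oplus> d \<otimes> q"
      using h(1,2) xc dc right_ideal_subset[OF L(1) h(3)] unfolding h(4) by (simp add: a_ac)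
    hence "\<one> \<in> ?M <+>\<^bsub>R\<^esub> principal_right_ideal R d"
      using h(1-3) unfolding set_add_def' principal_right_ideal_def by blast
    hence "?M = carrier R" by (rule small_principal_right_ideal[OF dc d(2) M])
    hence "\<one> \<in> ?M" by (simp only: one_closed)
    hence "L = carrier R" by (rule small_principal_right_ideal[OF xc x(2) L(1)])
    thus False using L(2) by contradiction
  qed
  \<comment> \<open>The homomorphism is computed from an arbitrary choice of coefficients.\<close>
  define rep where "rep y = (SOME pq. fst pq \<in> carrier R \<and> snd pq \<in> carrier R \<and> y = x \<otimes> fst pq \<oplus> d \<otimes> snd pq)" for y
  have rep: "fst (rep y) \<in> carrier R" "snd (rep y) \<in> carrier R"
      "y = x \<otimes> fst (rep y) \<oplus> d \<otimes> snd (rep y)" if y: "y \<in> ?K" for y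
  proof -
    obtain p q where "p \<in> carrier R" "q \<in> carrier R" "y = x \<otimes> p \<oplus> d \<otimes> q"
      using K_mem[OF y] by blast
    hence "\<exists>pq. fst pq \<in> carrier R \<and> snd pq \<in> carrier R \<and> y = x \<otimes> fst pq \<oplus> d \<otimes> snd pq"
      by (intro exI[of _ "(p, q)"]) simp
    from someI_ex[OF this] show "fst (rep y) \<in> carrier R" "snd (rep y) \<in> carrier R"
      "y = x \<otimes> fst (rep y) \<oplus> d \<otimes> snd (rep y)" unfolding rep_def by blast+
  qed
  define f where "f y = u \<otimes> fst (rep y) \<oplus> v \<otimes> snd (rep y)" for y
  have f: "f (x \<otimes> p \<oplus> d \<otimes> q) = u \<otimes> p \<oplus> v \<otimes> q" if pq: "p \<in> carrier R" "q \<in> carrier R" for p q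
  proof -
    let ?y = "x \<otimes> p \<oplus> d \<otimes> q"
    have y: "?y \<in> ?K" using pq unfolding set_add_def' principal_right_ideal_def by blast
    define p' q' where "p' = fst (rep ?y)" and "q' = snd (rep ?y)"
    have r: "p' \<in> carrier R" "q' \<in> carrier R" "x \<otimes> p \<oplus> d \<otimes> q = x \<otimes> p' \<oplus> d \<otimes> q'"
      using rep[OF y] unfolding p'_def q'_def by simp_all
    have split: "a \<otimes> (p' \<ominus> p) \<oplus> b \<otimes> (q' \<ominus> q) = (a \<otimes> p' \<oplus> b \<otimes> q') \<ominus> (a \<otimes> p \<oplus> b \<otimes> q)"
      if "a \<in> carrier R" "b \<in> carrier R" for a b
      using that pq r(1,2) by (simp add: minus_eq r_distr r_minus minus_add a_ac)
    have "x \<otimes> (p' \<ominus> p) \<oplus> d \<otimes> (q' \<ominus> q) = \<zero>"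
      unfolding split[OF xc dc] r(3) using r(1,2) xc dc by (simp add: minus_eq r_neg)
    hence "u \<otimes> (p' \<ominus> p) \<oplus> v \<otimes> (q' \<ominus> q) = \<zero>" using ann r pq by simp
    hence "(u \<otimes> p' \<oplus> v \<otimes> q') \<ominus> (u \<otimes> p \<oplus> v \<otimes> q) = \<zero>" unfolding split[OF u v] .
    hence "u \<otimes> p' \<oplus> v \<otimes> q' = u \<otimes> p \<oplus> v \<otimes> q"
      by (rule eq_of_minus_zero) (use u v r pq in simp_all)
    thus ?thesis unfolding f_def p'_def q'_def .
  qed
  have hom: "f \<in> right_hom R ?K"
    unfolding right_hom_def
  proof (intro CollectI conjI ballI Pi_I)
    fix y assume "y \<in> ?K"
    then obtain p q where y: "p \<in> carrier R" "q \<in> carrier R" "y = x \<otimes> p \<oplus> d \<otimes> q"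
      using K_mem by blast
    show "f y \<in> carrier R" unfolding y(3) f[OF y(1,2)] using y u v by simp
    {
      fix y' assume "y' \<in> ?K"
      then obtain p' q' where y': "p' \<in> carrier R" "q' \<in> carrier R" "y' = x \<otimes> p' \<oplus> d \<otimes> q'"
        using K_mem by blast
      have split: "(a \<otimes> p \<oplus> b \<otimes> q) \<oplus> (a \<otimes> p' \<oplus> b \<otimes> q') = a \<otimes> (p \<oplus> p') \<oplus> b \<otimes> (q \<oplus> q')"
        if "a \<in> carrier R" "b \<in> carrier R" for a b
        using that y(1,2) y'(1,2) by (simp add: r_distr a_ac)
      show "f (y \<oplus> y') = f y \<oplus> f y'"
        unfolding y(3) y'(3) f[OF y(1,2)] f[OF y'(1,2)] split[OF xc dc] split[OF u v]
        by (rule f) (use y y' in simp_all)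
    }
    fix r assume r: "r \<in> carrier R"
    have split: "(a \<otimes> p \<oplus> b \<otimes> q) \<otimes> r = a \<otimes> (p \<otimes> r) \<oplus> b \<otimes> (q \<otimes> r)"
      if "a \<in> carrier R" "b \<in> carrier R" for a b
      using that y(1,2) r by (simp add: l_distr m_assoc)
    show "f (y \<otimes> r) = f y \<otimes> r"
      unfolding y(3) f[OF y(1,2)] split[OF xc dc] split[OF u v]
      by (rule f) (use y r in simp_all)
  qed
  obtain g where g: "g \<in> right_hom R (carrier R)" "\<And>y. y \<in> ?K \<Longrightarrow> g y = f y"
    using inj semisimple small hom unfolding right_ss_injective_def by blast
  have g1: "g \<one> \<in> carrier R" using g(1) by (auto simp: right_hom_def)
  have gm: "g \<one> \<otimes> y = g y" if "y \<in> carrier R" for y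
  proof -
    have "g (\<one> \<otimes> y) = g \<one> \<otimes> y" using g(1) that one_closed unfolding right_hom_def by blast
    thus ?thesis using that by simp
  qed
  have "g \<one> \<otimes> x = u" 
    using gm[OF xc] g(2)[OF xK] f[OF one_closed zero_closed] xc dc u v by simp
  moreover have "g \<one> \<otimes> d = v"
    using gm[OF dc] g(2)[OF dK] f[OF zero_closed one_closed] xc dc u v by simp
  ultimately show thesis using that g1 by blast
qed

end

section \<open>Mininjectivity and annihilators\<close>

text \<open>
  The classical condition that the left annihilator of \<open>r(x)\<close> is \<open>Rx\<close> for every simple right ideal
  \<open>xR\<close>, with the trivial inclusion omitted.
\<close>

definition right_min_double_annihilator :: "('a, 'b) ring_scheme \<Rightarrow> bool" where
  "right_min_double_annihilator R \<longleftrightarrow>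
     (\<forall>x z. right_minimal R x \<and> z \<in> carrier R \<and>
        (\<forall>r\<in>carrier R. x \<otimes>\<^bsub>R\<^esub> r = \<zero>\<^bsub>R\<^esub> \<longrightarrow> z \<otimes>\<^bsub>R\<^esub> r = \<zero>\<^bsub>R\<^esub>) \<longrightarrow>
        (\<exists>c\<in>carrier R. z = c \<otimes>\<^bsub>R\<^esub> x))"

definition right_mininjective :: "('a, 'b) ring_scheme \<Rightarrow> bool" where
  "right_mininjective R \<longleftrightarrow>
     (\<forall>I. simple_right_ideal I R \<longrightarrow>
        (\<forall>f\<in>right_hom R I. \<exists>g\<in>right_hom R (carrier R). \<forall>x\<in>I. g x = f x))"

context ring
begin

lemma right_min_double_annihilatorD:
  assumes "right_min_double_annihilator R" "right_minimal R x" "z \<in> carrier R"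
    and "\<And>r. r \<in> carrier R \<Longrightarrow> x \<otimes> r = \<zero> \<Longrightarrow> z \<otimes> r = \<zero>"
  obtains c where "c \<in> carrier R" "z = c \<otimes> x"
  using assms unfolding right_min_double_annihilator_def by blast

lemma right_hom_carrier_left_mult:
  assumes "g \<in> right_hom R (carrier R)" "y \<in> carrier R"
  shows "g y = g \<one> \<otimes> y"
proof -
  have "g (\<one> \<otimes> y) = g \<one> \<otimes> y" using assms one_closed unfolding right_hom_def by blast
  thus ?thesis using assms(2) by simp
qed

text \<open>
  The homomorphisms from a simple \<open>xR\<close> are the maps \<open>xr \<mapsto> zr\<close> with \<open>r(x) \<subseteq> r(z)\<close>, and such a map
  extends to the whole ring precisely when it is left multiplication by some \<open>c\<close>, that is, \<open>z = cx\<close>.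
\<close>

lemma right_mininjective_iff: "right_mininjective R \<longleftrightarrow> right_min_double_annihilator R"
proof
  assume inj: "right_mininjective R"
  show "right_min_double_annihilator R"
    unfolding right_min_double_annihilator_def
  proof (intro allI impI, elim conjE)
    fix x z assume x: "right_minimal R x" and z: "z \<in> carrier R"
      and ann: "\<forall>r\<in>carrier R. x \<otimes> r = \<zero> \<longrightarrow> z \<otimes> r = \<zero>"
    note xc = right_minimalD(1)[OF x]
    let ?I = "principal_right_ideal R x"
    define f where "f y = z \<otimes> (SOME r. r \<in> carrier R \<and> y = x \<otimes> r)" for y
    have f: "f (x \<otimes> r) = z \<otimes> r" if r: "r \<in> carrier R" for r
    proof -
      define r' where "r' = (SOME t. t \<in> carrier R \<and> x \<otimes> r = x \<otimes> t)"
      have r': "r' \<in> carrier R" "x \<otimes> r = x \<otimes> r'"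
        using someI[of "\<lambda>t. t \<in> carrier R \<and> x \<otimes> r = x \<otimes> t" r] r unfolding r'_def by simp_all
      have split: "a \<otimes> (r' \<ominus> r) = a \<otimes> r' \<ominus> a \<otimes> r" if "a \<in> carrier R" for a
        using that r r'(1) by (simp add: minus_eq r_distr r_minus)
      have "x \<otimes> (r' \<ominus> r) = \<zero>"
        unfolding split[OF xc] r'(2) using r'(1) xc by (simp add: minus_eq r_neg)
      hence "z \<otimes> (r' \<ominus> r) = \<zero>" using ann r r'(1) by simp
      hence "z \<otimes> r' \<ominus> z \<otimes> r = \<zero>" unfolding split[OF z] .
      hence "z \<otimes> r' = z \<otimes> r" by (rule eq_of_minus_zero) (use z r r'(1) in simp_all)
      thus ?thesis unfolding f_def r'_def .
    qed
    have hom: "f \<in> right_hom R ?I"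
      unfolding right_hom_def
    proof (intro CollectI conjI ballI Pi_I)
      fix y assume "y \<in> ?I"
      then obtain p where y: "p \<in> carrier R" "y = x \<otimes> p" by (auto simp: principal_right_ideal_def)
      show "f y \<in> carrier R" unfolding y(2) f[OF y(1)] using y z by simp
      {
        fix y' assume "y' \<in> ?I"
        then obtain p' where y': "p' \<in> carrier R" "y' = x \<otimes> p'" by (auto simp: principal_right_ideal_def)
        show "f (y \<oplus> y') = f y \<oplus> f y'"
          unfolding y(2) y'(2) f[OF y(1)] f[OF y'(1)]
            r_distr[OF y(1) y'(1) xc, symmetric] r_distr[OF y(1) y'(1) z, symmetric]
          by (rule f[OF a_closed[OF y(1) y'(1)]])
      }
      fix r assume r: "r \<in> carrier R"
      show "f (y \<otimes> r) = f y \<otimes> r"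
        unfolding y(2) f[OF y(1)] m_assoc[OF xc y(1) r] m_assoc[OF z y(1) r]
        by (rule f[OF m_closed[OF y(1) r]])
    qed
    then obtain g where g: "g \<in> right_hom R (carrier R)" "\<And>y. y \<in> ?I \<Longrightarrow> g y = f y"
      using inj right_minimal_simple[OF x] unfolding right_mininjective_def by blast
    have "g \<one> \<in> carrier R" using g(1) one_closed by (auto simp: right_hom_def)
    moreover have "z = g \<one> \<otimes> x"
      using right_hom_carrier_left_mult[OF g(1) xc] g(2)[OF mem_principal_right_ideal[OF xc]]
        f[OF one_closed] xc z by simp
    ultimately show "\<exists>c\<in>carrier R. z = c \<otimes> x" by blast
  qed
next
  assume ann: "right_min_double_annihilator R"
  show "right_mininjective R"
    unfolding right_mininjective_def
  proof (intro allI impI ballI)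
    fix I f assume I: "simple_right_ideal I R" and f: "f \<in> right_hom R I"
    have Ir: "right_ideal I R" "I \<noteq> {\<zero>}" using I by (auto simp: simple_right_ideal_def)
    obtain x where x: "x \<in> I" "x \<noteq> \<zero>" using Ir right_ideal_closed(1) by blast
    have xc: "x \<in> carrier R" by (rule right_ideal_subset[OF Ir(1) x(1)])
    have fx: "f x \<in> carrier R" using f x(1) by (auto simp: right_hom_def)
    have fm: "f (x \<otimes> r) = f x \<otimes> r" if "r \<in> carrier R" for r
      using f x(1) that by (simp add: right_hom_def)
    have f0: "f \<zero> = \<zero>" using fm[OF zero_closed] xc fx by simp
    have "f x \<otimes> r = \<zero>" if "r \<in> carrier R" "x \<otimes> r = \<zero>" for r
      using fm[OF that(1)] that(2) f0 by simp
    then obtain c where c: "c \<in> carrier R" "f x = c \<otimes> x"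
      using right_min_double_annihilatorD[OF ann simple_right_ideal_minimal[OF I x] fx] by blast
    have "(\<lambda>y. c \<otimes> y) \<in> right_hom R (carrier R)"
      using c(1) by (auto simp: right_hom_def r_distr m_assoc)
    moreover have "c \<otimes> y = f y" if y: "y \<in> I" for y
    proof -
      obtain r where r: "r \<in> carrier R" "y = x \<otimes> r"
        using y simple_right_ideal_generator[OF I x] by (auto simp: principal_right_ideal_def)
      have "f y = c \<otimes> x \<otimes> r" unfolding r(2) fm[OF r(1)] c(2) ..
      thus ?thesis using m_assoc[OF c(1) xc r(1)] r(2) by simp
    qed
    ultimately show "\<exists>g\<in>right_hom R (carrier R). \<forall>x\<in>I. g x = f x" by blast
  qed
qed

text \<open>
  If \<open>xRx = 0\<close>, then \<open>xR\<close> is small and ss-injectivity applies. Otherwise \<open>xwx = x\<close> for some \<open>w\<close>, so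
  \<open>wx - 1 \<in> r(x) \<subseteq> r(z)\<close> and \<open>z = zwx\<close>.
\<close>

lemma ss_injective_double_annihilator:
  assumes inj: "right_ss_injective R"
  shows "right_min_double_annihilator R"
  unfolding right_min_double_annihilator_def
proof (intro allI impI, elim conjE)
  fix x z assume x: "right_minimal R x" and z: "z \<in> carrier R"
    and ann: "\<forall>r\<in>carrier R. x \<otimes> r = \<zero> \<longrightarrow> z \<otimes> r = \<zero>"
  note xc = right_minimalD(1)[OF x]
  from right_minimal_square_zero_or_idempotent[OF x]
  show "\<exists>c\<in>carrier R. z = c \<otimes> x"
  proof
    assume nil: "\<forall>r\<in>carrier R. x \<otimes> r \<otimes> x = \<zero>"
    have "z \<otimes> p \<oplus> z \<otimes> q = \<zero>"
      if "p \<in> carrier R" "q \<in> carrier R" "x \<otimes> p \<oplus> x \<otimes> q = \<zero>" for p q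
      using ann that(3) a_closed[OF that(1,2)]
      by (simp only: r_distr[OF that(1,2) xc, symmetric] r_distr[OF that(1,2) z, symmetric])
    then obtain c where "c \<in> carrier R" "c \<otimes> x = z"
      using ss_injective_left_multiplication[OF inj x nil x nil z z] by blast
    thus ?thesis by blast
  next
    assume "\<exists>w\<in>carrier R. x \<otimes> w \<otimes> x = x"
    then obtain w where w: "w \<in> carrier R" "x \<otimes> w \<otimes> x = x" by blast
    have "x \<otimes> (w \<otimes> x \<ominus> \<one>) = \<zero>"
      using w xc by (simp add: minus_eq r_distr r_minus m_assoc[symmetric] r_neg)
    hence "z \<otimes> (w \<otimes> x \<ominus> \<one>) = \<zero>" using ann w(1) xc by simp
    hence "z \<otimes> w \<otimes> x \<ominus> z = \<zero>"
      using w(1) xc z by (simp add: minus_eq r_distr r_minus m_assoc)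
    hence "z \<otimes> w \<otimes> x = z" by (rule eq_of_minus_zero) (use w(1) xc z in simp_all)
    thus ?thesis using w(1) z by (intro bexI[of _ "z \<otimes> w"]) simp_all
  qed
qed

end

section \<open>The opposite ring\<close>

definition opposite_ring :: "('a, 'b) ring_scheme \<Rightarrow> ('a, 'b) ring_scheme" where
  "opposite_ring R = R\<lparr>mult := \<lambda>x y. y \<otimes>\<^bsub>R\<^esub> x\<rparr>"

lemma opposite_ring_simps [simp]:
  "carrier (opposite_ring R) = carrier R"
  "x \<otimes>\<^bsub>opposite_ring R\<^esub> y = y \<otimes>\<^bsub>R\<^esub> x"
  "x \<oplus>\<^bsub>opposite_ring R\<^esub> y = x \<oplus>\<^bsub>R\<^esub> y"
  "\<zero>\<^bsub>opposite_ring R\<^esub> = \<zero>\<^bsub>R\<^esub>"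
  "\<one>\<^bsub>opposite_ring R\<^esub> = \<one>\<^bsub>R\<^esub>"
  "add (opposite_ring R) = add R"
  "opposite_ring (opposite_ring R) = R"
  by (simp_all add: opposite_ring_def)

context ring
begin

lemma opposite_ring: "ring (opposite_ring R)"
proof (rule ringI)
  show "abelian_group (opposite_ring R)"
    using abelian_group_axioms
    by (simp add: abelian_group_def abelian_group_axioms_def abelian_monoid_def)
  show "monoid (opposite_ring R)"
    by (rule monoidI) (simp_all add: m_assoc)
qed (simp_all add: l_distr r_distr)

lemma left_ideal_opposite: "left_ideal I R \<longleftrightarrow> right_ideal I (opposite_ring R)"
  using ring_axioms opposite_ring
  by (simp add: left_ideal_def right_ideal_def left_ideal_axioms_def right_ideal_axioms_def
      additive_subgroup_def)

lemma simple_left_ideal_opposite: "simple_left_ideal I R \<longleftrightarrow> simple_right_ideal I (opposite_ring R)"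
  by (simp add: simple_left_ideal_def simple_right_ideal_def left_ideal_opposite)

lemma left_socle_opposite: "left_socle R = right_socle (opposite_ring R)"
  by (simp add: left_soc_def right_soc_def simple_left_ideal_opposite)

lemma left_mininjective_opposite: "left_mininjective R \<longleftrightarrow> right_mininjective (opposite_ring R)"
  by (simp add: left_mininjective_def right_mininjective_def simple_left_ideal_opposite
      left_hom_def right_hom_def)

section \<open>Comparing the two socles\<close>

text \<open>
  Suppose that \<open>y = rx\<close> is nonzero. Left multiplication by \<open>r\<close> is an isomorphism of the simple module
  \<open>xR\<close> onto \<open>yR\<close>, so \<open>x\<close> and \<open>y\<close> have the same right annihilator, and the double annihilator condition
  for \<open>y\<close> gives \<open>x \<in> Ry\<close>.
\<close>

lemma double_annihilator_left_minimal:
  assumes ann: "right_min_double_annihilator R" and x: "right_minimal R x"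
  shows "right_minimal (opposite_ring R) x"
proof -
  note xc = right_minimalD(1)[OF x]
  have "\<exists>s\<in>carrier R. s \<otimes> (r \<otimes> x) = x" if r: "r \<in> carrier R" "r \<otimes> x \<noteq> \<zero>" for r
  proof -
    have rx: "r \<otimes> x \<in> carrier R" using r(1) xc by simp
    have "right_minimal R (r \<otimes> x)"
      by (rule right_minimal_annihilator[OF x rx r(2)]) (use r(1) xc in \<open>simp add: m_assoc\<close>)
    moreover have "x \<otimes> t = \<zero>" if t: "t \<in> carrier R" "r \<otimes> x \<otimes> t = \<zero>" for t
    proof (rule ccontr)
      assume "x \<otimes> t \<noteq> \<zero>"
      then obtain s where s: "s \<in> carrier R" "x \<otimes> t \<otimes> s = x" using right_minimalD(3)[OF x t(1)] by blast
      have "r \<otimes> (x \<otimes> t \<otimes> s) = r \<otimes> x \<otimes> t \<otimes> s" using r(1) xc t(1) s(1) by (simp add: m_assoc)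
      also have "\<dots> = \<zero>" using t(2) s(1) by simp
      finally show False using s(2) r(2) by simp
    qed
    ultimately obtain c where "c \<in> carrier R" "x = c \<otimes> (r \<otimes> x)"
      using right_min_double_annihilatorD[OF ann _ xc] by blast
    thus ?thesis by metis
  qed
  thus ?thesis using right_minimalD(1,2)[OF x] by (simp add: right_minimal_def)
qed

lemma double_annihilator_socle_subset:
  assumes "right_min_double_annihilator R"
  shows "right_socle R \<subseteq> right_socle (opposite_ring R)"
proof -
  have "{x. right_minimal R x} \<subseteq> {x. right_minimal (opposite_ring R) x}"
    using double_annihilator_left_minimal[OF assms] by blast
  from add.mono_generate[OF this] show ?thesis
    unfolding right_socle_eq_generate ring.right_socle_eq_generate[OF opposite_ring] by simp
qed

lemma left_minimalD:
  assumes "right_minimal (opposite_ring R) x"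
  shows "r \<in> carrier R \<Longrightarrow> r \<otimes> x \<noteq> \<zero> \<Longrightarrow> \<exists>s\<in>carrier R. s \<otimes> (r \<otimes> x) = x"
  using assms by (simp add: right_minimal_def)

text \<open>
  The left annihilator of a generator of a simple left ideal is a maximal left ideal, so the
  inclusion \<open>l(x) \<subseteq> l(z)\<close> for \<open>z \<noteq> 0\<close> can be reversed.
\<close>

lemma left_minimal_annihilator_maximal:
  assumes x: "right_minimal (opposite_ring R) x" "x \<in> carrier R"
    and z: "z \<in> carrier R" "z \<noteq> \<zero>"
    and ann: "\<And>r. r \<in> carrier R \<Longrightarrow> r \<otimes> x = \<zero> \<Longrightarrow> r \<otimes> z = \<zero>"
    and r: "r \<in> carrier R" "r \<otimes> z = \<zero>"
  shows "r \<otimes> x = \<zero>"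
proof (rule ccontr)
  assume "r \<otimes> x \<noteq> \<zero>"
  then obtain s where s: "s \<in> carrier R" "s \<otimes> (r \<otimes> x) = x" using left_minimalD[OF x(1) r(1)] by blast
  have split: "(s \<otimes> r \<ominus> \<one>) \<otimes> y = s \<otimes> (r \<otimes> y) \<ominus> y" if "y \<in> carrier R" for y
    using that s(1) r(1) by (simp add: minus_eq l_distr l_minus m_assoc)
  have "(s \<otimes> r \<ominus> \<one>) \<otimes> x = \<zero>"
    unfolding split[OF x(2)] s(2) using x(2) by (simp add: minus_eq r_neg)
  hence "(s \<otimes> r \<ominus> \<one>) \<otimes> z = \<zero>" using ann s(1) r(1) by simp
  hence "s \<otimes> \<zero> \<ominus> z = \<zero>" unfolding split[OF z(1)] r(2) .
  hence "s \<otimes> \<zero> = z" by (rule eq_of_minus_zero) (use s z in simp_all)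
  thus False using s(1) z(2) by simp
qed

text \<open>
  The core of the implication from equal socles to left mininjectivity: \<open>l(x) \<subseteq> l(a)\<close> forces
  \<open>a \<in> xR\<close>. An element \<open>a\<close> outside \<open>xR\<close> would yield a simple right ideal \<open>dR\<close> that meets \<open>xR\<close>
  trivially and still satisfies \<open>l(x) \<subseteq> l(d)\<close>, whereas ss-injectivity produces a left multiplier
  that annihilates \<open>x\<close> and fixes \<open>d\<close>.
\<close>

lemma ss_injective_socle_left_annihilator:
  assumes inj: "right_ss_injective R"
    and x: "right_minimal R x" "right_minimal (opposite_ring R) x"
    and a: "a \<in> right_socle R"
    and ann: "\<And>s. s \<in> carrier R \<Longrightarrow> s \<otimes> x = \<zero> \<Longrightarrow> s \<otimes> a = \<zero>"
  shows "a \<in> principal_right_ideal R x"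
proof (rule ccontr)
  assume not: "a \<notin> principal_right_ideal R x"
  note xc = right_minimalD(1)[OF x(1)] and ac = right_socle_carrier[OF a]
  have idem: "y \<otimes> w \<otimes> b = b"
    if "y \<in> carrier R" "w \<in> carrier R" "b \<in> carrier R" "(y \<otimes> w \<ominus> \<one>) \<otimes> b = \<zero>" for y w b
  proof -
    have "y \<otimes> w \<otimes> b \<ominus> b = \<zero>" using that by (simp add: minus_eq l_distr l_minus)
    thus ?thesis by (rule eq_of_minus_zero) (use that in simp_all)
  qed
  have fixed: "(y \<otimes> w \<ominus> \<one>) \<otimes> y = \<zero>"
    if "y \<in> carrier R" "w \<in> carrier R" "y \<otimes> w \<otimes> y = y" for y w
    using that by (simp add: minus_eq l_distr l_minus r_neg)
  \<comment> \<open>If \<open>xw\<close> were an idempotent fixing \<open>x\<close>, then \<open>xw - 1 \<in> l(x)\<close> would force \<open>a = xwa\<close>.\<close>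
  have "\<not> (\<exists>w\<in>carrier R. x \<otimes> w \<otimes> x = x)"
  proof
    assume "\<exists>w\<in>carrier R. x \<otimes> w \<otimes> x = x"
    then obtain w where w: "w \<in> carrier R" "x \<otimes> w \<otimes> x = x" by blast
    have "(x \<otimes> w \<ominus> \<one>) \<otimes> a = \<zero>" by (rule ann[OF _ fixed[OF xc w]]) (use xc w in simp)
    hence "x \<otimes> w \<otimes> a = a" by (rule idem[OF xc w(1) ac])
    hence "a = x \<otimes> (w \<otimes> a)" using m_assoc[OF xc w(1) ac] by simp
    thus False using not m_closed[OF w(1) ac] unfolding principal_right_ideal_def by blast
  qed
  hence x_nil: "\<forall>r\<in>carrier R. x \<otimes> r \<otimes> x = \<zero>"
    using right_minimal_square_zero_or_idempotent[OF x(1)] by blast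
  obtain C where C: "right_ideal C R" "x \<notin> C"
      "right_socle R \<subseteq> C <+>\<^bsub>R\<^esub> principal_right_ideal R x"
    using right_socle_complement[OF x(1)] by blast
  then obtain c r where c: "c \<in> C" "r \<in> carrier R" "a = c \<oplus> x \<otimes> r"
    using a by (auto simp: set_add_def' principal_right_ideal_def)
  note cc = right_ideal_subset[OF C(1) c(1)]
  have c0: "c \<noteq> \<zero>"
  proof
    assume "c = \<zero>"
    hence "a = x \<otimes> r" using c(2,3) xc by simp
    thus False using not c(2) unfolding principal_right_ideal_def by blast
  qed
  have c_eq: "c = x \<otimes> (\<ominus> r) \<oplus> a" using cc c(2) xc unfolding c(3) by (simp add: r_minus a_lcomm r_neg l_neg)
  have "c \<in> right_socle R"
  proof (cases "x \<otimes> (\<ominus> r) = \<zero>")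
    case True
    hence "c = a" using c_eq ac by simp
    thus ?thesis using a by simp
  next
    case False
    hence "right_minimal R (x \<otimes> (\<ominus> r))" using right_minimal_mult[OF x(1) a_inv_closed[OF c(2)]] by blast
    hence "x \<otimes> (\<ominus> r) \<oplus> a \<in> right_socle R" by (rule right_socle_closed(2)[OF right_socle_closed(1) a])
    thus ?thesis by (simp only: c_eq[symmetric])
  qed
  then obtain s where s: "s \<in> carrier R" "right_minimal R (c \<otimes> s)"
    using right_socle_contains_minimal c0 by blast
  define d where "d = c \<otimes> s"
  have d: "right_minimal R d" using s(2) by (simp only: d_def)
  note dc = right_minimalD(1,2)[OF d]
  have dC: "d \<in> C" unfolding d_def by (rule right_ideal_closed(3)[OF C(1) c(1) s(1)])
  have ann_d: "t \<otimes> d = \<zero>" if t: "t \<in> carrier R" "t \<otimes> x = \<zero>" for t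
  proof -
    have "t \<otimes> c = t \<otimes> x \<otimes> (\<ominus> r) \<oplus> t \<otimes> a"
      using t(1) c(2) xc ac by (subst c_eq) (simp add: r_distr m_assoc)
    also have "\<dots> = \<zero>" using t c(2) ann[OF t] by simp
    finally show ?thesis using t(1) cc s(1) by (simp add: d_def m_assoc[symmetric])
  qed
  \<comment> \<open>If \<open>dw\<close> were an idempotent fixing \<open>d\<close>, then by \<open>l(d) \<subseteq> l(x)\<close> it would also fix \<open>x\<close>, placing
    \<open>x\<close> in \<open>dR \<subseteq> C\<close>.\<close>
  have "\<not> (\<exists>w\<in>carrier R. d \<otimes> w \<otimes> d = d)"
  proof
    assume "\<exists>w\<in>carrier R. d \<otimes> w \<otimes> d = d"
    then obtain w where w: "w \<in> carrier R" "d \<otimes> w \<otimes> d = d" by blast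
    have "(d \<otimes> w \<ominus> \<one>) \<otimes> x = \<zero>"
      by (rule left_minimal_annihilator_maximal[OF x(2) xc dc ann_d _ fixed[OF dc(1) w]])
        (use dc w in simp_all)
    hence "d \<otimes> w \<otimes> x = x" by (rule idem[OF dc(1) w(1) xc])
    thus False
      using right_ideal_closed(3)[OF C(1) right_ideal_closed(3)[OF C(1) dC w(1)] xc] C(2) by simp
  qed
  hence d_nil: "\<forall>r\<in>carrier R. d \<otimes> r \<otimes> d = \<zero>"
    using right_minimal_square_zero_or_idempotent[OF d] by blast
  \<comment> \<open>The sum \<open>xR + dR\<close> is direct because \<open>C\<close> contains \<open>d\<close> and meets \<open>xR\<close> trivially.\<close>
  have independent: "\<zero> \<otimes> p \<oplus> d \<otimes> q = \<zero>"
    if pq: "p \<in> carrier R" "q \<in> carrier R" "x \<otimes> p \<oplus> d \<otimes> q = \<zero>" for p q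
  proof -
    have dq: "d \<otimes> q \<in> C" by (rule right_ideal_closed(3)[OF C(1) dC pq(2)])
    have eq: "\<ominus> (d \<otimes> q) = x \<otimes> p" using minus_equality[OF pq(3)] pq xc dc by simp
    have xp: "x \<otimes> p = \<zero>"
    proof (rule ccontr)
      assume "x \<otimes> p \<noteq> \<zero>"
      then obtain t where t: "t \<in> carrier R" "x \<otimes> p \<otimes> t = x" using right_minimalD(3)[OF x(1) pq(1)] by blast
      have "x \<otimes> p \<in> C" using right_ideal_closed(4)[OF C(1) dq] eq by simp
      thus False using right_ideal_closed(3)[OF C(1) _ t(1)] t(2) C(2) by metis
    qed
    thus ?thesis using pq dc by simp
  qed
  obtain t where "t \<in> carrier R" "t \<otimes> x = \<zero>" "t \<otimes> d = d"
    using ss_injective_left_multiplication[OF inj x(1) x_nil d d_nil zero_closed dc(1) independent]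
    by blast
  thus False using ann_d dc(2) by simp
qed

end

theorem proposition4p14:
  fixes R :: "('a, 'b) ring_scheme"
  assumes "ring R"
    and "right_ss_injective R"
  shows "(left_socle R \<subseteq> right_socle R \<longleftrightarrow> left_socle R = right_socle R) \<and>
         (left_socle R = right_socle R \<longleftrightarrow> left_mininjective R)"
proof -
  interpret R: ring R by fact
  interpret L: ring "opposite_ring R" by (rule R.opposite_ring)
  have right_le_left: "right_socle R \<subseteq> left_socle R"
    unfolding R.left_socle_opposite
    by (rule R.double_annihilator_socle_subset[OF R.ss_injective_double_annihilator[OF assms(2)]])
  have mininj: "left_mininjective R \<longleftrightarrow> right_min_double_annihilator (opposite_ring R)"
    unfolding R.left_mininjective_opposite by (rule L.right_mininjective_iff)
  have left_le_right: "left_socle R \<subseteq> right_socle R" if "left_mininjective R"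
    using L.double_annihilator_socle_subset that mininj R.left_socle_opposite by simp
  have "left_mininjective R" if eq: "left_socle R = right_socle R"
    unfolding mininj right_min_double_annihilator_def opposite_ring_simps
  proof (intro allI impI, elim conjE)
    fix x z assume x: "right_minimal (opposite_ring R) x" and z: "z \<in> carrier R"
      and ann': "\<forall>r\<in>carrier R. r \<otimes>\<^bsub>R\<^esub> x = \<zero>\<^bsub>R\<^esub> \<longrightarrow> r \<otimes>\<^bsub>R\<^esub> z = \<zero>\<^bsub>R\<^esub>"
    hence ann: "r \<otimes>\<^bsub>R\<^esub> z = \<zero>\<^bsub>R\<^esub>" if "r \<in> carrier R" "r \<otimes>\<^bsub>R\<^esub> x = \<zero>\<^bsub>R\<^esub>" for r
      using that by blast
    have xc: "x \<in> carrier R" "x \<noteq> \<zero>\<^bsub>R\<^esub>" using L.right_minimalD(1,2)[OF x] by simp_all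
    have left_minimal_mem: "y \<in> right_socle R" if "right_minimal (opposite_ring R) y" for y
      using L.right_socle_closed(1)[OF that] eq R.left_socle_opposite by simp
    show "\<exists>c\<in>carrier R. z = x \<otimes>\<^bsub>R\<^esub> c"
    proof (cases "z = \<zero>\<^bsub>R\<^esub>")
      case True
      thus ?thesis using xc by (intro bexI[of _ "\<zero>\<^bsub>R\<^esub>"]) simp_all
    next
      case False
      have "right_minimal (opposite_ring R) z"
        by (rule L.right_minimal_annihilator[OF x]) (use z False ann in simp_all)
      hence z_soc: "z \<in> right_socle R" by (rule left_minimal_mem)
      \<comment> \<open>The ideal \<open>xR\<close> need not be simple; replace \<open>x\<close> by a multiple \<open>y\<close> that generates a simple
        right ideal and has the same left annihilator.\<close>
      obtain s where s: "s \<in> carrier R" "right_minimal R (x \<otimes>\<^bsub>R\<^esub> s)"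
        using R.right_socle_contains_minimal[OF left_minimal_mem[OF x] xc(2)] by blast
      define y where "y = x \<otimes>\<^bsub>R\<^esub> s"
      have y: "right_minimal R y" using s(2) by (simp only: y_def)
      note yc = R.right_minimalD(1,2)[OF y]
      have ann_y: "r \<otimes>\<^bsub>R\<^esub> y = \<zero>\<^bsub>R\<^esub>" if "r \<in> carrier R" "r \<otimes>\<^bsub>R\<^esub> x = \<zero>\<^bsub>R\<^esub>" for r
        using that s(1) xc(1) by (simp add: y_def R.m_assoc[symmetric])
      have y_left: "right_minimal (opposite_ring R) y"
        by (rule L.right_minimal_annihilator[OF x]) (use yc ann_y in simp_all)
      have "r \<otimes>\<^bsub>R\<^esub> z = \<zero>\<^bsub>R\<^esub>" if "r \<in> carrier R" "r \<otimes>\<^bsub>R\<^esub> y = \<zero>\<^bsub>R\<^esub>" for r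
        using ann[OF that(1)] R.left_minimal_annihilator_maximal[OF x xc(1) yc ann_y that] by blast
      hence "z \<in> principal_right_ideal R y"
        using R.ss_injective_socle_left_annihilator[OF assms(2) y y_left z_soc] by blast
      then obtain t where t: "t \<in> carrier R" "z = y \<otimes>\<^bsub>R\<^esub> t"
        by (auto simp: principal_right_ideal_def)
      hence "z = x \<otimes>\<^bsub>R\<^esub> (s \<otimes>\<^bsub>R\<^esub> t)" using s(1) xc(1) by (simp add: y_def R.m_assoc)
      thus ?thesis using s(1) t(1) by blast
    qed
  qed
  thus ?thesis using right_le_left left_le_right by blast
qed

end
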